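(* Let $(M^{2n+s},f,\vec\xi,\vec\eta,g)$ be a nearly $\mathcal C$-manifold with contact distribution $\mathcal D=\bigcap_{i=1}^s\ker\eta^i$. Then $\mathcal D$ is curvature invariant: $R_{X,Y}Z\in\mathcal D$ for all $X,Y,Z\in\mathcal D$.
   Context: $\nabla$ is the Levi-Civita connection of $g$ and $R_{X,Y}=[\nabla_X,\nabla_Y]-\nabla_{[X,Y]}$. A metric $f$-structure on a smooth manifold $M^{2n+s}$ ($n,s>0$) is a set $(f,\vec\xi,\vec\eta,g)$, where $g$ is a Riemannian metric, $f$ is a $g$-skew-symmetric $(1,1)$-tensor of rank $2n$, $\vec\xi=(\xi_1,\dots,\xi_s)$ are orthonormal vector fields and $\vec\eta=(\eta^1,\dots,\eta^s)$ are dual 1-forms, such that $f^2=-\mathrm{Id}+\sum_i\eta^i\otimes\xi_i$, $\eta^i(\xi_j)=\delta^i_j$, and $g(fX,fY)=g(X,Y)-\sum_i\eta^i(X)\eta^i(Y)$ for all vector fields $X,Y$. A nearly $\mathcal C$-manifold is a manifold with a metric $f$-structure such that $(\nabla_Xf)Y+(\nabla_Yf)X=0$ for all vector fields $X,Y$. *)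

theory Defs
  imports "HOL-Analysis.Analysis" "HOL-Library.Function_Algebras"
begin

(* Functions into a real vector space form a real vector space pointwise. This makes the
   library notions "dim", "sum", "+", "*\<^sub>R" available for tangent vectors and vector fields. *)
instantiation "fun" :: (type, real_vector) real_vector
begin

definition scaleR_fun :: "real \<Rightarrow> ('a \<Rightarrow> 'b) \<Rightarrow> 'a \<Rightarrow> 'b"
  where "scaleR_fun c h = (\<lambda>x. c *\<^sub>R h x)"

instance
  by standard (simp_all add: scaleR_fun_def fun_eq_iff scaleR_add_right scaleR_add_left)

end

definition linear_over :: "'a::real_vector set \<Rightarrow> ('a \<Rightarrow> 'b::real_vector) \<Rightarrow> bool"
  where "linear_over V L \<longleftrightarrow>
    (\<forall>u\<in>V. \<forall>v\<in>V. L (u + v) = L u + L v) \<and> (\<forall>c. \<forall>u\<in>V. L (c *\<^sub>R u) = c *\<^sub>R L u)"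


section \<open>Smooth manifolds\<close>

(* C^k maps on an open set S: all iterated directional derivatives up to order k exist as
   Frechet derivatives and those of order k are continuous. *)
primrec Ck_on :: "nat \<Rightarrow> 'a::real_normed_vector set \<Rightarrow> ('a \<Rightarrow> 'b::real_normed_vector) \<Rightarrow> bool"
  where
    "Ck_on 0 S h \<longleftrightarrow> continuous_on S h"
  | "Ck_on (Suc k) S h \<longleftrightarrow>
       (\<forall>x\<in>S. h differentiable (at x)) \<and> (\<forall>v. Ck_on k S (\<lambda>x. frechet_derivative h (at x) v))"

definition smooth_on :: "'a::real_normed_vector set \<Rightarrow> ('a \<Rightarrow> 'b::real_normed_vector) \<Rightarrow> bool"
  where "smooth_on S h \<longleftrightarrow> (\<forall>k. Ck_on k S h)"

type_synonym ('m, 'e) chart = "'m set \<times> ('m \<Rightarrow> 'e)"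

(* The manifold is the whole type 'm, a second countable Hausdorff space, modelled on the
   Euclidean space 'e; its dimension is DIM('e). The atlas need not be maximal: it determines
   the same smooth functions as the maximal atlas containing it. *)
definition smooth_atlas ::
    "('m::{t2_space,second_countable_topology}, 'e::euclidean_space) chart set \<Rightarrow> bool"
  where "smooth_atlas A \<longleftrightarrow>
    (\<Union>(U, \<phi>)\<in>A. U) = UNIV \<and>
    (\<forall>(U, \<phi>)\<in>A. open U \<and> open (\<phi> ` U) \<and> homeomorphism U (\<phi> ` U) \<phi> (inv_into U \<phi>)) \<and>
    (\<forall>(U, \<phi>)\<in>A. \<forall>(V, \<psi>)\<in>A. smooth_on (\<phi> ` (U \<inter> V)) (\<psi> \<circ> inv_into U \<phi>))"

definition smooth_functions :: "('m, 'e::euclidean_space) chart set \<Rightarrow> ('m \<Rightarrow> real) set"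
  where "smooth_functions A = {h. \<forall>(U, \<phi>)\<in>A. smooth_on (\<phi> ` U) (h \<circ> inv_into U \<phi>)}"

type_synonym 'm tangent = "('m \<Rightarrow> real) \<Rightarrow> real"
type_synonym 'm field = "'m \<Rightarrow> 'm tangent"

(* Tangent vectors at p are the derivations at p of the algebra of smooth functions. Setting
   them to 0 on non-smooth functions makes equality of tangent vectors HOL equality. *)
definition tangent_space :: "('m, 'e::euclidean_space) chart set \<Rightarrow> 'm \<Rightarrow> 'm tangent set"
  where "tangent_space A p = {v.
    linear_over (smooth_functions A) v \<and>
    (\<forall>h\<in>smooth_functions A. \<forall>k\<in>smooth_functions A.
        v (\<lambda>q. h q * k q) = v h * k p + h p * v k) \<and>
    (\<forall>h. h \<notin> smooth_functions A \<longrightarrow> v h = 0)}"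

definition vector_field :: "('m, 'e::euclidean_space) chart set \<Rightarrow> 'm field \<Rightarrow> bool"
  where "vector_field A X \<longleftrightarrow>
    (\<forall>p. X p \<in> tangent_space A p) \<and>
    (\<forall>h\<in>smooth_functions A. (\<lambda>p. X p h) \<in> smooth_functions A)"

definition section_of ::
    "('m, 'e::euclidean_space) chart set \<Rightarrow> ('m \<Rightarrow> 'm tangent set) \<Rightarrow> 'm field \<Rightarrow> bool"
  where "section_of A D X \<longleftrightarrow> vector_field A X \<and> (\<forall>p. X p \<in> D p)"

definition lie_bracket :: "'m field \<Rightarrow> 'm field \<Rightarrow> 'm field"
  where "lie_bracket X Y = (\<lambda>p h. X p (\<lambda>q. Y q h) - Y p (\<lambda>q. X q h))"

definition one_form ::
    "('m, 'e::euclidean_space) chart set \<Rightarrow> ('m \<Rightarrow> 'm tangent \<Rightarrow> real) \<Rightarrow> bool"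
  where "one_form A \<alpha> \<longleftrightarrow>
    (\<forall>p. linear_over (tangent_space A p) (\<alpha> p)) \<and>
    (\<forall>X. vector_field A X \<longrightarrow> (\<lambda>p. \<alpha> p (X p)) \<in> smooth_functions A)"

definition app_field :: "('m \<Rightarrow> 'm tangent \<Rightarrow> 'm tangent) \<Rightarrow> 'm field \<Rightarrow> 'm field"
  where "app_field f X = (\<lambda>p. f p (X p))"

definition tensor11 ::
    "('m, 'e::euclidean_space) chart set \<Rightarrow> ('m \<Rightarrow> 'm tangent \<Rightarrow> 'm tangent) \<Rightarrow> bool"
  where "tensor11 A f \<longleftrightarrow>
    (\<forall>p. linear_over (tangent_space A p) (f p) \<and> f p ` tangent_space A p \<subseteq> tangent_space A p) \<and>
    (\<forall>X. vector_field A X \<longrightarrow> vector_field A (app_field f X))"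


section \<open>Riemannian metrics, the Levi-Civita connection and curvature\<close>

type_synonym 'm metric_tensor = "'m \<Rightarrow> 'm tangent \<Rightarrow> 'm tangent \<Rightarrow> real"

definition inner_fields :: "'m metric_tensor \<Rightarrow> 'm field \<Rightarrow> 'm field \<Rightarrow> 'm \<Rightarrow> real"
  where "inner_fields g X Y = (\<lambda>p. g p (X p) (Y p))"

definition riemannian_metric ::
    "('m, 'e::euclidean_space) chart set \<Rightarrow> 'm metric_tensor \<Rightarrow> bool"
  where "riemannian_metric A g \<longleftrightarrow>
    (\<forall>p. \<forall>u\<in>tangent_space A p.
        linear_over (tangent_space A p) (g p u) \<and>
        (\<forall>v\<in>tangent_space A p. g p u v = g p v u) \<and>
        (u \<noteq> 0 \<longrightarrow> g p u u > 0)) \<and>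
    (\<forall>X Y. vector_field A X \<longrightarrow> vector_field A Y \<longrightarrow> inner_fields g X Y \<in> smooth_functions A)"

type_synonym 'm connection = "'m field \<Rightarrow> 'm field \<Rightarrow> 'm field"

definition affine_connection ::
    "('m, 'e::euclidean_space) chart set \<Rightarrow> 'm connection \<Rightarrow> bool"
  where "affine_connection A nabla \<longleftrightarrow>
    (\<forall>X Y. vector_field A X \<longrightarrow> vector_field A Y \<longrightarrow> vector_field A (nabla X Y)) \<and>
    (\<forall>X Y Z. vector_field A X \<longrightarrow> vector_field A Y \<longrightarrow> vector_field A Z \<longrightarrow>
        nabla (X + Y) Z = nabla X Z + nabla Y Z \<and>
        nabla X (Y + Z) = nabla X Y + nabla X Z) \<and>
    (\<forall>h X Y. h \<in> smooth_functions A \<longrightarrow> vector_field A X \<longrightarrow> vector_field A Y \<longrightarrow>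
        nabla (\<lambda>p. h p *\<^sub>R X p) Y = (\<lambda>p. h p *\<^sub>R nabla X Y p) \<and>
        nabla X (\<lambda>p. h p *\<^sub>R Y p) = (\<lambda>p. X p h *\<^sub>R Y p + h p *\<^sub>R nabla X Y p))"

definition levi_civita ::
    "('m, 'e::euclidean_space) chart set \<Rightarrow> 'm metric_tensor \<Rightarrow> 'm connection \<Rightarrow> bool"
  where "levi_civita A g nabla \<longleftrightarrow>
    affine_connection A nabla \<and>
    (\<forall>X Y. vector_field A X \<longrightarrow> vector_field A Y \<longrightarrow>
        nabla X Y - nabla Y X = lie_bracket X Y) \<and>
    (\<forall>X Y Z. vector_field A X \<longrightarrow> vector_field A Y \<longrightarrow> vector_field A Z \<longrightarrow>
        (\<forall>p. X p (inner_fields g Y Z) =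
             inner_fields g (nabla X Y) Z p + inner_fields g Y (nabla X Z) p))"

definition curvature :: "'m connection \<Rightarrow> 'm field \<Rightarrow> 'm field \<Rightarrow> 'm field \<Rightarrow> 'm field"
  where "curvature nabla X Y Z =
    nabla X (nabla Y Z) - nabla Y (nabla X Z) - nabla (lie_bracket X Y) Z"

(* (nabla_X f) Y *)
definition cov_deriv11 ::
    "'m connection \<Rightarrow> ('m \<Rightarrow> 'm tangent \<Rightarrow> 'm tangent) \<Rightarrow> 'm field \<Rightarrow> 'm field \<Rightarrow> 'm field"
  where "cov_deriv11 nabla f X Y = nabla X (app_field f Y) - app_field f (nabla X Y)"


section \<open>Nearly C-manifolds\<close>

definition metric_f_structure ::
    "('m::{t2_space,second_countable_topology}, 'e::euclidean_space) chart set \<Rightarrow> nat \<Rightarrow> nat \<Rightarrow>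
     ('m \<Rightarrow> 'm tangent \<Rightarrow> 'm tangent) \<Rightarrow> (nat \<Rightarrow> 'm field) \<Rightarrow>
     (nat \<Rightarrow> 'm \<Rightarrow> 'm tangent \<Rightarrow> real) \<Rightarrow> 'm metric_tensor \<Rightarrow> bool"
  where "metric_f_structure A n s f \<xi> \<eta> g \<longleftrightarrow>
    n > 0 \<and> s > 0 \<and> DIM('e) = 2 * n + s \<and> smooth_atlas A \<and>
    riemannian_metric A g \<and>
    tensor11 A f \<and>
    (\<forall>p. \<forall>u\<in>tangent_space A p. \<forall>v\<in>tangent_space A p. g p (f p u) v = - g p u (f p v)) \<and>
    (\<forall>p. dim (f p ` tangent_space A p) = 2 * n) \<and>
    (\<forall>i\<in>{1..s}. vector_field A (\<xi> i)) \<and>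
    (\<forall>p. \<forall>i\<in>{1..s}. \<forall>j\<in>{1..s}. g p (\<xi> i p) (\<xi> j p) = (if i = j then 1 else 0)) \<and>
    (\<forall>i\<in>{1..s}. one_form A (\<eta> i)) \<and>
    (\<forall>p. \<forall>i\<in>{1..s}. \<forall>j\<in>{1..s}. \<eta> i p (\<xi> j p) = (if i = j then 1 else 0)) \<and>
    (\<forall>p. \<forall>v\<in>tangent_space A p. f p (f p v) = - v + (\<Sum>i=1..s. \<eta> i p v *\<^sub>R \<xi> i p)) \<and>
    (\<forall>X Y. vector_field A X \<longrightarrow> vector_field A Y \<longrightarrow>
        (\<forall>p. g p (f p (X p)) (f p (Y p)) = g p (X p) (Y p) - (\<Sum>i=1..s. \<eta> i p (X p) * \<eta> i p (Y p))))"

definition nearly_C_manifold ::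
    "('m::{t2_space,second_countable_topology}, 'e::euclidean_space) chart set \<Rightarrow> nat \<Rightarrow> nat \<Rightarrow>
     ('m \<Rightarrow> 'm tangent \<Rightarrow> 'm tangent) \<Rightarrow> (nat \<Rightarrow> 'm field) \<Rightarrow>
     (nat \<Rightarrow> 'm \<Rightarrow> 'm tangent \<Rightarrow> real) \<Rightarrow> 'm metric_tensor \<Rightarrow> 'm connection \<Rightarrow> bool"
  where "nearly_C_manifold A n s f \<xi> \<eta> g nabla \<longleftrightarrow>
    metric_f_structure A n s f \<xi> \<eta> g \<and>
    levi_civita A g nabla \<and>
    (\<forall>X Y. vector_field A X \<longrightarrow> vector_field A Y \<longrightarrow>
        cov_deriv11 nabla f X Y + cov_deriv11 nabla f Y X = 0)"

definition contact_distribution ::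
    "('m, 'e::euclidean_space) chart set \<Rightarrow> nat \<Rightarrow> (nat \<Rightarrow> 'm \<Rightarrow> 'm tangent \<Rightarrow> real) \<Rightarrow>
     'm \<Rightarrow> 'm tangent set"
  where "contact_distribution A s \<eta> p = (\<Inter>i\<in>{1..s}. {v \<in> tangent_space A p. \<eta> i p v = 0})"

end

(* Write T(X;Y,Z,W) = g((nabla^2_{X,Y} f)Z, W), which is totally skew in Y, Z, W, and A = nabla_xi f
   for one of the characteristic fields xi. The Ricci identity expresses the derivation action of f
   on the curvature by T. On the horizontal fields (f^2 X = -X) one has Af + fA = 0, and
   differentiating this relation gives T(X;xi,fZ,W) - T(X;xi,Z,fW) as a quadratic expression in
   nabla f. Combined with the Bianchi and Ricci identities it yields R(fY,W,xi,Y) = 0 for horizontal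
   Y, W. Hence r(X,Y,Z) = R(X,Y,xi,Z) makes r(X,Y,fZ) totally skew, and since f annihilates R as
   a derivation, r = 0 follows by linear algebra. No second-order expression in xi is needed: T
   replaces nabla^2 xi, so the (for s > 1 possibly nonzero) vertical part of nabla xi never enters. *)
theory Submission
  imports Defs
begin

section \<open>Smooth functions and vector fields\<close>

text \<open>Derivatives at points of an open set depend only on the germ there. The recursion in
  \<open>Ck_on\<close> can therefore use derivative formulas that hold only on
  \<open>S\<close>.\<close>

lemma Ck_on_cong:
  assumes "open S" "\<And>x. x \<in> S \<Longrightarrow> h x = k x"
  shows "Ck_on n S h \<longleftrightarrow> Ck_on n S k"
  using assms(2)
proof (induction n arbitrary: h k)
  case 0
  then show ?case
    by (simp cong: continuous_on_cong)
next
  case (Suc n)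
  have der: "(h has_derivative D) (at x) \<longleftrightarrow> (k has_derivative D) (at x)" if "x \<in> S" for x D
    using has_derivative_transform_within_open[OF _ \<open>open S\<close> that, of h D UNIV k]
      has_derivative_transform_within_open[OF _ \<open>open S\<close> that, of k D UNIV h] Suc.prems
    by auto
  have "frechet_derivative h (at x) = frechet_derivative k (at x)" if "x \<in> S" for x
    using der[OF that] by (simp add: frechet_derivative_def)
  then have "Ck_on n S (\<lambda>x. frechet_derivative h (at x) v)
      \<longleftrightarrow> Ck_on n S (\<lambda>x. frechet_derivative k (at x) v)" for v
    by (intro Suc.IH) simp
  with der show ?case
    by (simp add: differentiable_def)
qed

lemma Ck_on_diff:
  assumes "open S" "Ck_on n S h" "Ck_on n S k"
  shows "Ck_on n S (\<lambda>x. h x - k x)"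
  using assms(2,3)
proof (induction n arbitrary: h k)
  case 0
  then show ?case
    by (simp add: continuous_on_diff)
next
  case (Suc n)
  have "frechet_derivative (\<lambda>x. h x - k x) (at x) v
      = frechet_derivative h (at x) v - frechet_derivative k (at x) v" if "x \<in> S" for x v
  proof -
    have "((\<lambda>x. h x - k x) has_derivative
        (\<lambda>v. frechet_derivative h (at x) v - frechet_derivative k (at x) v)) (at x)"
      using Suc.prems that by (auto intro: has_derivative_diff simp: frechet_derivative_works)
    from frechet_derivative_at[OF this] show ?thesis
      by metis
  qed
  then have "Ck_on n S (\<lambda>x. frechet_derivative (\<lambda>x. h x - k x) (at x) v) \<longleftrightarrow>
      Ck_on n S (\<lambda>x. frechet_derivative h (at x) v - frechet_derivative k (at x) v)" for v
    by (intro Ck_on_cong[OF assms(1)]) simp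
  with Suc show ?case
    by (simp add: differentiable_diff)
qed

lemma smooth_functions_diff:
  assumes "smooth_atlas A" "h \<in> smooth_functions A" "k \<in> smooth_functions A"
  shows "(\<lambda>q. h q - k q) \<in> smooth_functions A"
proof -
  have "smooth_on (\<phi> ` U) ((\<lambda>q. h q - k q) \<circ> inv_into U \<phi>)" if "(U, \<phi>) \<in> A" for U \<phi>
  proof -
    have "open (\<phi> ` U)"
      using assms(1) that by (auto simp: smooth_atlas_def)
    moreover have "smooth_on (\<phi> ` U) (h \<circ> inv_into U \<phi>)" "smooth_on (\<phi> ` U) (k \<circ> inv_into U \<phi>)"
      using assms(2,3) that by (auto simp: smooth_functions_def)
    ultimately show ?thesis
      using Ck_on_diff[of "\<phi> ` U" _ "h \<circ> inv_into U \<phi>" "k \<circ> inv_into U \<phi>"]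
      by (auto simp: smooth_on_def o_def)
  qed
  then show ?thesis
    by (auto simp: smooth_functions_def)
qed

lemma subspace_tangent_space: "subspace (tangent_space A p)"
  unfolding subspace_def tangent_space_def linear_over_def
  by (auto simp: scaleR_fun_def algebra_simps)

lemma linear_over_diff:
  assumes "subspace V" "linear_over V L" "u \<in> V" "v \<in> V"
  shows "L (u - v) = L u - L v"
proof -
  have "L ((u - v) + v) = L (u - v) + L v"
    using assms subspace_diff[of V u v] unfolding linear_over_def by blast
  then show ?thesis
    by simp
qed

lemma linear_over_sum:
  assumes "subspace V" "linear_over V L" "\<And>i. i \<in> I \<Longrightarrow> b i \<in> V"
  shows "L (\<Sum>i\<in>I. c i *\<^sub>R b i) = (\<Sum>i\<in>I. c i *\<^sub>R L (b i))"
  using assms(3)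
proof (induction I rule: infinite_finite_induct)
  case (insert i I)
  then have "(\<Sum>i\<in>I. c i *\<^sub>R b i) \<in> V"
    by (intro subspace_sum subspace_scale assms(1)) auto
  with insert assms(2) show ?case
    by (simp add: linear_over_def subspace_scale[OF assms(1)])
\<comment> \<open>Sums over an infinite or an empty index set are 0, and \<open>L 0 = 0\<close> is
  linearity at 0 - 0.\<close>
qed (use linear_over_diff[OF assms(1,2), of 0 0] subspace_0[OF assms(1)] in simp_all)

lemma vector_field_diff:
  assumes "smooth_atlas A" "vector_field A X" "vector_field A Y"
  shows "vector_field A (X - Y)"
  using assms smooth_functions_diff[OF assms(1)]
  by (auto simp: vector_field_def subspace_diff[OF subspace_tangent_space])

lemma vector_field_smooth_diff:
  assumes "smooth_atlas A" "vector_field A X" "h \<in> smooth_functions A" "k \<in> smooth_functions A"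
  shows "X p (\<lambda>q. h q - k q) = X p h - X p k"
proof -
  let ?d = "\<lambda>q. h q - k q"
  have "X p (?d + k) = X p ?d + X p k"
    using assms smooth_functions_diff[OF assms(1,3,4)]
    unfolding vector_field_def tangent_space_def linear_over_def by blast
  moreover have "?d + k = h"
    by (simp add: fun_eq_iff)
  ultimately show ?thesis
    by simp
qed

section \<open>The Levi-Civita connection\<close>

locale riemannian_manifold =
  fixes A :: "('m::{t2_space,second_countable_topology}, 'e::euclidean_space) chart set"
    and g :: "'m metric_tensor"
    and nabla :: "'m connection"
  assumes atlas: "smooth_atlas A"
    and metric: "riemannian_metric A g"
    and levi_civita: "levi_civita A g nabla"
begin

abbreviation vf :: "'m field \<Rightarrow> bool"
  where "vf \<equiv> vector_field A"

abbreviation ip :: "'m field \<Rightarrow> 'm field \<Rightarrow> 'm \<Rightarrow> real"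
  where "ip \<equiv> inner_fields g"

lemma vf_tangent: "vf X \<Longrightarrow> X p \<in> tangent_space A p"
  by (simp add: vector_field_def)

lemma vf_diff [simp]: "vf X \<Longrightarrow> vf Y \<Longrightarrow> vf (X - Y)"
  using vector_field_diff[OF atlas] .

text \<open>Closure under differences suffices: 0 is \<open>X - X\<close>, and \<open>- X\<close> is
  0 - X. Negatives under \<open>nabla\<close>, \<open>ip\<close> and \<open>F\<close> are handled in
  the same way.\<close>

lemma vf_minus [simp]: "vf X \<Longrightarrow> vf (- X)"
  using vf_diff[of X X] vf_diff[of "X - X" X] by simp

lemma vf_add [simp]: "vf X \<Longrightarrow> vf Y \<Longrightarrow> vf (X + Y)"
  using vf_diff[of X "- Y"] by simp

lemma vf_nabla [simp]: "vf X \<Longrightarrow> vf Y \<Longrightarrow> vf (nabla X Y)"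
  using levi_civita by (simp add: levi_civita_def affine_connection_def)

lemma nabla_add:
  assumes "vf X" "vf Y" "vf Z"
  shows "nabla (X + Y) Z = nabla X Z + nabla Y Z" "nabla X (Y + Z) = nabla X Y + nabla X Z"
  using levi_civita assms by (simp_all add: levi_civita_def affine_connection_def)

lemma nabla_diff:
  assumes "vf X" "vf Y" "vf Z"
  shows "nabla (X - Y) Z = nabla X Z - nabla Y Z" "nabla X (Y - Z) = nabla X Y - nabla X Z"
  using nabla_add(1)[of "X - Y" Y Z] nabla_add(2)[of X "Y - Z" Z] assms by simp_all

lemma nabla_minus:
  assumes "vf X" "vf Y"
  shows "nabla (- X) Y = - nabla X Y" "nabla X (- Y) = - nabla X Y"
  using nabla_diff[of "X - X" X Y] nabla_diff[of X X Y] nabla_diff[of X "Y - Y" Y]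
    nabla_diff[of X Y Y] assms vf_diff[of X X] vf_diff[of Y Y] by simp_all

lemma lie_bracket_eq:
  assumes "vf X" "vf Y"
  shows "lie_bracket X Y = nabla X Y - nabla Y X"
  using levi_civita assms by (simp add: levi_civita_def)

lemma vf_lie_bracket [simp]: "vf X \<Longrightarrow> vf Y \<Longrightarrow> vf (lie_bracket X Y)"
  by (simp add: lie_bracket_eq)

lemma vf_curvature [simp]: "vf X \<Longrightarrow> vf Y \<Longrightarrow> vf Z \<Longrightarrow> vf (curvature nabla X Y Z)"
  by (simp add: curvature_def)

lemma g_linear: "u \<in> tangent_space A p \<Longrightarrow> linear_over (tangent_space A p) (g p u)"
  using metric by (simp add: riemannian_metric_def)

lemma g_commute:
  "u \<in> tangent_space A p \<Longrightarrow> v \<in> tangent_space A p \<Longrightarrow> g p u v = g p v u"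
  using metric by (simp add: riemannian_metric_def)

lemma g_eq_zero: "u \<in> tangent_space A p \<Longrightarrow> g p u u = 0 \<Longrightarrow> u = 0"
  using metric unfolding riemannian_metric_def by (metis less_irrefl)

lemma ip_commute: "vf X \<Longrightarrow> vf Y \<Longrightarrow> ip X Y p = ip Y X p"
  by (simp add: inner_fields_def g_commute vf_tangent)

lemma ip_diff_right: "vf X \<Longrightarrow> vf Y \<Longrightarrow> vf Z \<Longrightarrow> ip X (Y - Z) p = ip X Y p - ip X Z p"
  by (simp add: inner_fields_def linear_over_diff[OF subspace_tangent_space g_linear] vf_tangent)

lemma ip_diff_left: "vf X \<Longrightarrow> vf Y \<Longrightarrow> vf Z \<Longrightarrow> ip (X - Y) Z p = ip X Z p - ip Y Z p"
  using ip_diff_right[of Z X Y] by (simp add: ip_commute)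

lemma ip_minus:
  assumes "vf X" "vf Y"
  shows "ip (- X) Y p = - ip X Y p" "ip X (- Y) p = - ip X Y p"
  using ip_diff_left[of "X - X" X Y] ip_diff_left[of X X Y] ip_diff_right[of X "Y - Y" Y]
    ip_diff_right[of X Y Y] assms vf_diff[of X X] vf_diff[of Y Y] by simp_all

lemma ip_add:
  assumes "vf X" "vf Y" "vf Z"
  shows "ip (X + Y) Z p = ip X Z p + ip Y Z p" "ip X (Y + Z) p = ip X Y p + ip X Z p"
  using ip_diff_left[of X "- Y" Z] ip_diff_right[of X Y "- Z"] assms by (simp_all add: ip_minus)

lemma ip_zero:
  assumes "vf X"
  shows "ip 0 X p = 0" "ip X 0 p = 0"
  using ip_diff_left[of X X X] ip_diff_right[of X X X] assms by simp_all

lemmas ip_linear = ip_diff_left ip_diff_right ip_minus ip_add ip_zero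

lemmas nabla_linear = nabla_diff nabla_minus nabla_add

lemma ip_self_eq_zero:
  assumes "vf X" "\<And>p. ip X X p = 0"
  shows "X = 0"
proof (rule ext)
  fix p
  show "X p = 0 p"
    using g_eq_zero[OF vf_tangent[OF assms(1)], of p] assms(2)[of p]
    by (simp add: inner_fields_def)
qed

lemma ip_smooth: "vf X \<Longrightarrow> vf Y \<Longrightarrow> ip X Y \<in> smooth_functions A"
  using metric by (simp add: riemannian_metric_def)

lemma vf_smooth: "vf X \<Longrightarrow> h \<in> smooth_functions A \<Longrightarrow> (\<lambda>q. X q h) \<in> smooth_functions A"
  by (simp add: vector_field_def)

lemma nabla_metric:
  assumes "vf X" "vf Y" "vf Z"
  shows "X p (ip Y Z) = ip (nabla X Y) Z p + ip Y (nabla X Z) p"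
  using levi_civita assms by (simp add: levi_civita_def)

section \<open>Symmetries of the Riemann curvature tensor\<close>

abbreviation Rm :: "'m field \<Rightarrow> 'm field \<Rightarrow> 'm field \<Rightarrow> 'm field \<Rightarrow> 'm \<Rightarrow> real"
  where "Rm X Y Z W \<equiv> ip (curvature nabla X Y Z) W"

lemma curvature_add:
  assumes "vf X" "vf X'" "vf Y" "vf Z"
  shows "curvature nabla (X + X') Y Z = curvature nabla X Y Z + curvature nabla X' Y Z"
  using assms by (simp add: curvature_def lie_bracket_eq nabla_linear algebra_simps)

lemma curvature_minus:
  assumes "vf X" "vf Y" "vf Z"
  shows "curvature nabla (- X) Y Z = - curvature nabla X Y Z"
    and "curvature nabla X (- Y) Z = - curvature nabla X Y Z"
  using assms by (simp_all add: curvature_def lie_bracket_eq nabla_linear algebra_simps)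

lemma curvature_skew:
  assumes "vf X" "vf Y" "vf Z"
  shows "curvature nabla Y X Z = - curvature nabla X Y Z"
  using assms by (simp add: curvature_def lie_bracket_eq nabla_linear algebra_simps)

lemma Rm_skew12:
  assumes "vf X" "vf Y" "vf Z" "vf W"
  shows "Rm Y X Z W p = - Rm X Y Z W p"
  using assms by (simp add: curvature_skew[of X Y Z] ip_linear)

lemma lie_bracket_apply_diff:
  assumes "vf X" "vf Y" "vf Z" "h \<in> smooth_functions A"
  shows "lie_bracket X (lie_bracket Y Z) p h =
    X p (\<lambda>q. Y q (\<lambda>r. Z r h)) - X p (\<lambda>q. Z q (\<lambda>r. Y r h))
    - Y p (\<lambda>q. Z q (\<lambda>r. X r h)) + Z p (\<lambda>q. Y q (\<lambda>r. X r h))"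
  using vector_field_smooth_diff[OF atlas assms(1)
      vf_smooth[OF assms(2) vf_smooth[OF assms(3,4)]]
      vf_smooth[OF assms(3) vf_smooth[OF assms(2,4)]]]
  by (simp add: lie_bracket_def)

lemma jacobi:
  assumes "vf X" "vf Y" "vf Z"
  shows "lie_bracket X (lie_bracket Y Z) + lie_bracket Y (lie_bracket Z X)
    + lie_bracket Z (lie_bracket X Y) = 0" (is "?J = 0")
proof (intro ext)
  fix p h
  show "?J p h = 0 p h"
  proof (cases "h \<in> smooth_functions A")
    case True
    with assms show ?thesis
      by (simp add: lie_bracket_apply_diff)
  next
    case False
    \<comment> \<open>Off the smooth functions a tangent vector is 0 by convention, and the left
      side is a vector field.\<close>
    have "vf ?J"
      using assms by simp
    with False show ?thesis
      using vf_tangent[of ?J p] by (simp add: tangent_space_def)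
  qed
qed

text \<open>Vanishing torsion groups the second derivatives into
  \<open>nabla X (lie_bracket Y Z)\<close> and its cyclic mates. With the derivatives along brackets
  these form double brackets, which cancel by the Jacobi identity.\<close>

lemma bianchi:
  assumes "vf X" "vf Y" "vf Z"
  shows "curvature nabla X Y Z + curvature nabla Y Z X + curvature nabla Z X Y = 0"
proof -
  have "curvature nabla X Y Z + curvature nabla Y Z X + curvature nabla Z X Y
      = lie_bracket X (lie_bracket Y Z) + lie_bracket Y (lie_bracket Z X)
        + lie_bracket Z (lie_bracket X Y)"
    using assms by (simp add: curvature_def lie_bracket_eq nabla_linear algebra_simps)
  with jacobi[OF assms] show ?thesis
    by simp
qed

lemma Rm_bianchi:
  assumes "vf X" "vf Y" "vf Z" "vf W"
  shows "Rm X Y Z W p + Rm Y Z X W p + Rm Z X Y W p = 0"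
proof -
  have "ip (curvature nabla X Y Z + curvature nabla Y Z X + curvature nabla Z X Y) W p = 0"
    using assms by (simp add: bianchi ip_linear)
  with assms show ?thesis
    by (simp add: ip_linear)
qed

text \<open>The two middle terms are symmetric in \<open>X\<close> and \<open>Y\<close>. They cancel
  in the commutator, which yields the skewness of the curvature in its last two arguments.\<close>

lemma second_deriv_ip:
  assumes "vf X" "vf Y" "vf Z" "vf W"
  shows "X p (\<lambda>q. Y q (ip Z W)) = ip (nabla X (nabla Y Z)) W p + ip (nabla Y Z) (nabla X W) p
    + ip (nabla X Z) (nabla Y W) p + ip Z (nabla X (nabla Y W)) p"
proof -
  \<comment> \<open>The metric identity is solved for one term so that a difference of smooth
    functions gets differentiated.\<close>
  have "ip Z (nabla Y W) = (\<lambda>q. Y q (ip Z W) - ip (nabla Y Z) W q)"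
    using nabla_metric[OF assms(2-4)] by (simp add: fun_eq_iff)
  then have "X p (ip Z (nabla Y W)) = X p (\<lambda>q. Y q (ip Z W) - ip (nabla Y Z) W q)"
    by simp
  also have "\<dots> = X p (\<lambda>q. Y q (ip Z W)) - X p (ip (nabla Y Z) W)"
    using assms
    by (intro vector_field_smooth_diff[OF atlas] vf_smooth[OF assms(2) ip_smooth] ip_smooth) simp_all
  finally show ?thesis
    using nabla_metric[of X "nabla Y Z" W p] nabla_metric[of X Z "nabla Y W" p] assms by simp
qed

lemma Rm_skew34:
  assumes "vf X" "vf Y" "vf Z" "vf W"
  shows "Rm X Y W Z p = - Rm X Y Z W p"
proof -
  have "lie_bracket X Y p (ip Z W) =
      ip (nabla X (nabla Y Z)) W p + ip Z (nabla X (nabla Y W)) p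
      - ip (nabla Y (nabla X Z)) W p - ip Z (nabla Y (nabla X W)) p"
    using assms by (simp add: lie_bracket_def second_deriv_ip)
  with assms show ?thesis
    by (simp add: nabla_metric curvature_def ip_linear ip_commute[of _ Z])
qed

text \<open>Milnor's octahedron: four Bianchi identities are combined by skewness in both
  pairs.\<close>

lemma Rm_pair:
  assumes X: "vf X" and Y: "vf Y" and Z: "vf Z" and W: "vf W"
  shows "Rm X Y Z W p = Rm Z W X Y p"
proof -
  note B = Rm_bianchi[where p=p] and S = Rm_skew12[where p=p] and K = Rm_skew34[where p=p]
  show ?thesis
    using B[OF X Y Z W] B[OF Y Z W X] B[OF Z W X Y] B[OF W X Y Z]
      K[OF Y Z X W] K[OF Z W X Y] S[OF Y W Z X] S[OF X W Z Y] K[OF X W Y Z] S[OF Z X W Y]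
      K[OF Z X Y W] S[OF X W Y Z] K[OF X Y Z W] K[OF Y W Z X]
    by linarith
qed

end

text \<open>For trilinear \<open>r\<close>, with \<open>J\<close> squaring to -1 in each slot, the
  derivation action of \<open>J\<close> has the complex eigenvalues i, -i, 3i, -3i and never 0, so a
  form annihilated by it vanishes. The elimination below does this with real identities.\<close>

lemma skew_complex_form_zero:
  fixes r :: "'a \<Rightarrow> 'a \<Rightarrow> 'a \<Rightarrow> real"
  assumes skew: "\<And>X Y Z. H X \<Longrightarrow> H Y \<Longrightarrow> H Z \<Longrightarrow> r Y X Z = - r X Y Z"
    and J1: "\<And>X Y Z. H X \<Longrightarrow> H Y \<Longrightarrow> H Z \<Longrightarrow> r (J (J X)) Y Z = - r X Y Z"
    and J3: "\<And>X Y Z. H X \<Longrightarrow> H Y \<Longrightarrow> H Z \<Longrightarrow> r X Y (J (J Z)) = - r X Y Z"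
    and deriv: "\<And>X Y Z. H X \<Longrightarrow> H Y \<Longrightarrow> H Z \<Longrightarrow> r (J X) Y Z + r X (J Y) Z + r X Y (J Z) = 0"
    and polar: "\<And>X Y Z. H X \<Longrightarrow> H Y \<Longrightarrow> H Z \<Longrightarrow> r (J X) Y Z + r (J Z) Y X = 0"
    and J: "\<And>X. H X \<Longrightarrow> H (J X)"
    and X: "H X" and Y: "H Y" and Z: "H Z"
  shows "r X Y Z = 0"
proof -
  define m where "m X Y Z = r X Y (J Z)" for X Y Z
  have m12: "m Y X Z = - m X Y Z" if "H X" "H Y" "H Z" for X Y Z
    unfolding m_def by (rule skew[OF that(1,2) J[OF that(3)]])
  have m13: "m Z Y X = - m X Y Z" if "H X" "H Y" "H Z" for X Y Z
    using polar[OF J[OF that(1)] that(2) J[OF that(3)]] J1[OF that(1,2) J[OF that(3)]]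
      J1[OF that(3,2) J[OF that(1)]]
    unfolding m_def by linarith
  have mJ1: "m (J (J X)) Y Z = - m X Y Z" if "H X" "H Y" "H Z" for X Y Z
    unfolding m_def by (rule J1[OF that(1,2) J[OF that(3)]])
  have mJ2: "m X (J (J Y)) Z = - m X Y Z" if "H X" "H Y" "H Z" for X Y Z
    using mJ1[OF that(2,1,3)] m12[OF that(1) J[OF J[OF that(2)]] that(3)] m12[OF that] by linarith
  have mJ3: "m X Y (J (J Z)) = - m X Y Z" if "H X" "H Y" "H Z" for X Y Z
    unfolding m_def by (rule J3[OF that(1,2) J[OF that(3)]])
  have deriv_m: "m (J X) Y Z + m X (J Y) Z + m X Y (J Z) = 0" if "H X" "H Y" "H Z" for X Y Z
    using deriv[OF that(1,2) J[OF that(3)]] unfolding m_def .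
  \<comment> \<open>Let a, b, c be \<open>m\<close> with \<open>J\<close> in slots 1 and 2, 1 and 3,
    2 and 3. The three instances read a + b = a + c = b + c = \<open>m X Y Z\<close>, whence each is
    half of it.\<close>
  have half: "2 * m (J X) (J Y) Z = m X Y Z" if "H X" "H Y" "H Z" for X Y Z
    using deriv_m[OF J[OF that(1)] that(2,3)] deriv_m[OF that(1) J[OF that(2)] that(3)]
      deriv_m[OF that(1,2) J[OF that(3)]] mJ1[OF that] mJ2[OF that] mJ3[OF that]
    by linarith
  \<comment> \<open>Two uses of \<open>half\<close> give \<open>m (J (J X)) (J (J Y)) Z\<close> as a
    quarter of \<open>m X Y Z\<close>, while two sign changes show that they are equal.\<close>
  have zero: "m X Y Z = 0" if "H X" "H Y" "H Z" for X Y Z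
    using half[OF that] half[OF J[OF that(1)] J[OF that(2)] that(3)]
      mJ1[OF that(1) J[OF J[OF that(2)]] that(3)] mJ2[OF that]
    by linarith
  show ?thesis
    using zero[OF X Y J[OF Z]] J3[OF X Y Z] unfolding m_def by linarith
qed

section \<open>Nearly C-manifolds\<close>

locale nearly_C = riemannian_manifold A g nabla
  for A :: "('m::{t2_space,second_countable_topology}, 'e::euclidean_space) chart set"
    and g nabla +
  fixes n s :: nat and f :: "'m \<Rightarrow> 'm tangent \<Rightarrow> 'm tangent"
    and \<xi> :: "nat \<Rightarrow> 'm field" and \<eta> :: "nat \<Rightarrow> 'm \<Rightarrow> 'm tangent \<Rightarrow> real"
  assumes nearly_C: "nearly_C_manifold A n s f \<xi> \<eta> g nabla"
begin

abbreviation F :: "'m field \<Rightarrow> 'm field"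
  where "F \<equiv> app_field f"

abbreviation dF :: "'m field \<Rightarrow> 'm field \<Rightarrow> 'm field"
  where "dF \<equiv> cov_deriv11 nabla f"

section \<open>Algebra of the metric \<open>f\<close>-structure\<close>

lemma f_structure: "metric_f_structure A n s f \<xi> \<eta> g"
  using nearly_C by (simp add: nearly_C_manifold_def)

lemma f_tangent: "v \<in> tangent_space A p \<Longrightarrow> f p v \<in> tangent_space A p"
  using f_structure by (auto simp: metric_f_structure_def tensor11_def)

lemma f_skew:
  "u \<in> tangent_space A p \<Longrightarrow> v \<in> tangent_space A p \<Longrightarrow> g p (f p u) v = - g p u (f p v)"
  using f_structure by (simp add: metric_f_structure_def)

lemma f_squared:
  "v \<in> tangent_space A p \<Longrightarrow> f p (f p v) = - v + (\<Sum>i=1..s. \<eta> i p v *\<^sub>R \<xi> i p)"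
  using f_structure by (simp add: metric_f_structure_def)

lemma vf_xi [simp]: "i \<in> {1..s} \<Longrightarrow> vf (\<xi> i)"
  using f_structure by (simp add: metric_f_structure_def)

text \<open>The square of \<open>f\<close> kills \<open>\<xi> i\<close>, and skewness turns the
  squared length of \<open>f p (\<xi> i p)\<close> into a pairing with that square.\<close>

lemma f_xi:
  assumes "i \<in> {1..s}"
  shows "f p (\<xi> i p) = 0"
proof -
  let ?x = "\<xi> i p"
  have x: "?x \<in> tangent_space A p"
    using assms by (simp add: vf_tangent)
  have "\<eta> j p ?x *\<^sub>R \<xi> j p = (if j = i then \<xi> j p else 0)" if "j \<in> {1..s}" for j
    using f_structure assms that by (auto simp: metric_f_structure_def)
  then have "(\<Sum>j=1..s. \<eta> j p ?x *\<^sub>R \<xi> j p) = (\<Sum>j=1..s. if j = i then \<xi> j p else 0)"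
    by (intro sum.cong) auto
  also have "\<dots> = ?x"
    using assms by simp
  finally have "(\<Sum>j=1..s. \<eta> j p ?x *\<^sub>R \<xi> j p) = ?x" .
  then have "f p (f p ?x) = 0"
    using x by (simp add: f_squared)
  moreover have "g p ?x 0 = 0"
    using linear_over_diff[OF subspace_tangent_space g_linear[OF x] x x] by simp
  ultimately have "g p (f p ?x) (f p ?x) = 0"
    using f_skew[OF x f_tangent[OF x]] by simp
  then show ?thesis
    by (intro g_eq_zero[OF f_tangent[OF x]])
qed

text \<open>Pair \<open>f_squared\<close> with \<open>\<xi> i\<close>: by skewness and
  \<open>f_xi\<close> the left side vanishes, and orthonormality leaves only the i-th coefficient of
  the sum.\<close>

lemma eta_eq:
  assumes "i \<in> {1..s}" "v \<in> tangent_space A p"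
  shows "\<eta> i p v = g p (\<xi> i p) v"
proof -
  have x: "\<xi> j p \<in> tangent_space A p" if "j \<in> {1..s}" for j
    using that by (simp add: vf_tangent)
  let ?S = "\<Sum>j=1..s. \<eta> j p v *\<^sub>R \<xi> j p"
  have S: "?S \<in> tangent_space A p"
    using x by (intro subspace_sum subspace_scale subspace_tangent_space) auto
  have "\<eta> j p v *\<^sub>R g p (\<xi> i p) (\<xi> j p) = (if j = i then \<eta> j p v else 0)" if "j \<in> {1..s}" for j
    using f_structure assms that by (auto simp: metric_f_structure_def)
  then have "(\<Sum>j=1..s. \<eta> j p v *\<^sub>R g p (\<xi> i p) (\<xi> j p))
      = (\<Sum>j=1..s. if j = i then \<eta> j p v else 0)"
    by (intro sum.cong) auto
  also have "\<dots> = \<eta> i p v"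
    using assms(1) by simp
  finally have "g p (\<xi> i p) ?S = \<eta> i p v"
    using linear_over_sum[OF subspace_tangent_space g_linear[OF x[OF assms(1)]], of "{1..s}"] x
    by simp
  moreover have "g p (\<xi> i p) (f p (f p v)) = g p (\<xi> i p) ?S - g p (\<xi> i p) v"
    using linear_over_diff[OF subspace_tangent_space g_linear[OF x[OF assms(1)]] S assms(2)]
    by (simp add: f_squared[OF assms(2)])
  moreover have "g p (\<xi> i p) (f p (f p v)) = - g p 0 (f p v)"
    using f_skew[OF x[OF assms(1)] f_tangent[OF assms(2)]] f_xi[OF assms(1)] by simp
  moreover have "g p 0 (f p v) = 0"
  proof -
    have fv: "f p v \<in> tangent_space A p"
      by (rule f_tangent[OF assms(2)])
    show ?thesis
      using linear_over_diff[OF subspace_tangent_space g_linear[OF fv] fv fv]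
        g_commute[OF fv subspace_0[OF subspace_tangent_space]] by simp
  qed
  ultimately show ?thesis
    by simp
qed

lemma vf_F [simp]: "vf X \<Longrightarrow> vf (F X)"
  using f_structure by (simp add: metric_f_structure_def tensor11_def)

lemma F_diff:
  assumes "vf X" "vf Y"
  shows "F (X - Y) = F X - F Y"
proof (rule ext)
  fix p
  have "linear_over (tangent_space A p) (f p)"
    using f_structure by (simp add: metric_f_structure_def tensor11_def)
  with assms show "F (X - Y) p = (F X - F Y) p"
    by (simp add: app_field_def linear_over_diff[OF subspace_tangent_space] vf_tangent)
qed

lemma F_minus: "vf X \<Longrightarrow> F (- X) = - F X"
  using F_diff[of "X - X" X] F_diff[of X X] vf_diff[of X X] by simp

lemma F_add: "vf X \<Longrightarrow> vf Y \<Longrightarrow> F (X + Y) = F X + F Y"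
  using F_diff[of X "- Y"] by (simp add: F_minus)

lemmas F_linear = F_diff F_minus F_add

lemma F_skew: "vf X \<Longrightarrow> vf Y \<Longrightarrow> ip (F X) Y p = - ip X (F Y) p"
  by (simp add: inner_fields_def app_field_def f_skew vf_tangent)

lemma F_xi: "i \<in> {1..s} \<Longrightarrow> F (\<xi> i) = 0"
  by (simp add: fun_eq_iff app_field_def f_xi)

lemma F_F_eq:
  assumes "vf X" "\<And>i p. i \<in> {1..s} \<Longrightarrow> \<eta> i p (X p) = 0"
  shows "F (F X) = - X"
proof (rule ext)
  fix p
  have "(\<Sum>i=1..s. \<eta> i p (X p) *\<^sub>R \<xi> i p) = 0"
    using assms(2) by (intro sum.neutral) simp
  with assms(1) show "F (F X) p = (- X) p"
    by (simp add: app_field_def f_squared vf_tangent fun_eq_iff)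
qed

lemma F_cubed:
  assumes "vf X"
  shows "F (F (F X)) = - F X"
proof (rule F_F_eq)
  fix i p assume i: "i \<in> {1..s}"
  have "\<eta> i p (F X p) = ip (\<xi> i) (F X) p"
    using i assms by (simp add: eta_eq vf_tangent inner_fields_def)
  also have "\<dots> = - ip (F (\<xi> i)) X p"
    using i assms by (simp add: F_skew)
  finally show "\<eta> i p (F X p) = 0"
    using i assms by (simp add: F_xi ip_zero)
qed (use assms in simp)

text \<open>Amounts to being a section of the contact distribution, since the vertical part of
  \<open>X\<close> must vanish. This form involves only \<open>F\<close>.\<close>

definition hor :: "'m field \<Rightarrow> bool"
  where "hor X \<longleftrightarrow> vf X \<and> F (F X) = - X"

lemma hor_F_F [simp]: "hor X \<Longrightarrow> F (F X) = - X"
  by (simp add: hor_def)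

lemma hor_F [simp]: "vf X \<Longrightarrow> hor (F X)"
  by (simp add: hor_def F_cubed)

lemma hor_add [simp]: "hor X \<Longrightarrow> hor Y \<Longrightarrow> hor (X + Y)"
  by (simp add: hor_def F_add)

lemma hor_section: "section_of A (contact_distribution A s \<eta>) X \<Longrightarrow> hor X"
  by (auto simp: section_of_def contact_distribution_def hor_def intro!: F_F_eq)

lemma hor_vf [simp]: "hor X \<Longrightarrow> vf X"
  unfolding hor_def by (rule conjunct1)

section \<open>The covariant derivative of \<open>f\<close>\<close>

lemma vf_dF [simp]: "vf X \<Longrightarrow> vf Y \<Longrightarrow> vf (dF X Y)"
  by (simp add: cov_deriv11_def)

lemma dF_add:
  assumes "vf X" "vf Y" "vf Z"
  shows "dF (X + Y) Z = dF X Z + dF Y Z" "dF X (Y + Z) = dF X Y + dF X Z"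
  using assms by (simp_all add: cov_deriv11_def nabla_linear F_linear algebra_simps)

lemma dF_swap:
  assumes "vf X" "vf Y"
  shows "dF X Y = - dF Y X"
  using nearly_C assms by (simp add: nearly_C_manifold_def eq_neg_iff_add_eq_0)

lemma dF_self:
  assumes "vf X"
  shows "dF X X = 0"
proof (intro ext)
  fix p h
  have "dF X X p h = - dF X X p h"
    using dF_swap[OF assms assms] by (metis uminus_apply)
  then show "dF X X p h = 0 p h"
    by simp
qed

text \<open>Differentiate the skewness of \<open>f\<close>. Together with \<open>dF_swap\<close> it
  makes g((nabla_X f)Y, Z) a 3-form.\<close>

lemma dF_skew:
  assumes "vf X" "vf Y" "vf Z"
  shows "ip (dF X Y) Z p = - ip Y (dF X Z) p"
proof -
  have "ip (F Y) Z = (\<lambda>q. ip Y (- F Z) q)"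
    using assms by (simp add: fun_eq_iff F_skew ip_linear)
  then have "X p (ip (F Y) Z) = X p (ip Y (- F Z))"
    by simp
  with assms show ?thesis
    by (simp add: cov_deriv11_def nabla_metric ip_linear nabla_linear F_skew)
qed

text \<open>Differentiate f^2 = -Id + (vertical projection). On a horizontal field the derivative of
  the projection is vertical, so pairing with horizontal \<open>Z\<close> removes it.\<close>

lemma dF_anticommute:
  assumes "vf X" "hor Y" "hor Z"
  shows "ip (dF X (F Y)) Z p = - ip (F (dF X Y)) Z p"
proof -
  have "ip (F (F (nabla X Y))) Z p = - ip (nabla X Y) Z p"
    using assms by (simp add: F_skew ip_linear)
  with assms show ?thesis
    by (simp add: cov_deriv11_def F_linear ip_linear nabla_linear)
qed

section \<open>The second covariant derivative of \<open>f\<close> and the Ricci identity\<close>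

definition d2F :: "'m field \<Rightarrow> 'm field \<Rightarrow> 'm field \<Rightarrow> 'm field"
  where "d2F X Y Z = nabla X (dF Y Z) - dF (nabla X Y) Z - dF Y (nabla X Z)"

abbreviation T :: "'m field \<Rightarrow> 'm field \<Rightarrow> 'm field \<Rightarrow> 'm field \<Rightarrow> 'm \<Rightarrow> real"
  where "T X Y Z W \<equiv> ip (d2F X Y Z) W"

lemma vf_d2F [simp]: "vf X \<Longrightarrow> vf Y \<Longrightarrow> vf Z \<Longrightarrow> vf (d2F X Y Z)"
  by (simp add: d2F_def)

text \<open>For fixed \<open>X\<close>, \<open>T X\<close> is the derivative of the 3-form nabla f
  and so again totally skew; this and \<open>T_swap23\<close> give the two generating
  transpositions.\<close>

lemma T_swap12:
  assumes "vf X" "vf Y" "vf Z" "vf W"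
  shows "T X Z Y W p = - T X Y Z W p"
proof -
  have "d2F X Z Y = - d2F X Y Z"
    using assms
    by (simp add: d2F_def dF_swap[of Z Y] dF_swap[of "nabla X Z" Y] dF_swap[of Z "nabla X Y"]
        nabla_linear)
  with assms show ?thesis
    by (simp add: ip_linear)
qed

lemma T_swap23:
  assumes "vf X" "vf Y" "vf Z" "vf W"
  shows "T X Y W Z p = - T X Y Z W p"
proof -
  have "ip (dF Y Z) W = (\<lambda>q. ip Z (- dF Y W) q)"
    using assms by (simp add: fun_eq_iff dF_skew ip_linear)
  then have "X p (ip (dF Y Z) W) = X p (ip Z (- dF Y W))"
    by simp
  then have "T X Y Z W p = - ip Z (d2F X Y W) p"
    using assms
    by (simp add: d2F_def nabla_metric ip_linear nabla_linear dF_skew)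
  with assms show ?thesis
    by (simp add: ip_commute)
qed

text \<open>The commutator of second derivatives is the curvature acting on \<open>f\<close>;
  vanishing torsion matches the remaining first-order terms with the bracket term.\<close>

lemma ricci:
  assumes "vf X" "vf Y" "vf Z" "vf W"
  shows "Rm X Y (F Z) W p + Rm X Y Z (F W) p = T X Y Z W p - T Y X Z W p"
proof -
  have "d2F X Y Z - d2F Y X Z = curvature nabla X Y (F Z) - F (curvature nabla X Y Z)"
    using assms
    by (simp add: d2F_def cov_deriv11_def curvature_def lie_bracket_eq nabla_linear F_linear
        algebra_simps)
  then have "ip (d2F X Y Z - d2F Y X Z) W p
      = ip (curvature nabla X Y (F Z) - F (curvature nabla X Y Z)) W p"
    by simp
  with assms show ?thesis
    by (simp add: ip_linear F_skew)
qed

text \<open>The derivation action of \<open>f\<close> on the curvature tensor is totally skew, being the exterior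
  derivative of the 3-form \<open>\<nabla>f\<close>; it also inherits the Bianchi identity, so it vanishes.\<close>

lemma curvature_f_derivation:
  assumes X: "vf X" and Y: "vf Y" and Z: "vf Z" and W: "vf W"
  shows "Rm (F X) Y Z W p + Rm X (F Y) Z W p + Rm X Y (F Z) W p + Rm X Y Z (F W) p = 0"
proof -
  define E where "E X Y Z W =
    Rm (F X) Y Z W p + Rm X (F Y) Z W p + Rm X Y (F Z) W p + Rm X Y Z (F W) p" for X Y Z W
  \<comment> \<open>\<open>ricci\<close> handles the last two summands directly; pair symmetry
    brings the first two to the same shape.\<close>
  have E_eq: "E X Y Z W = T X Y Z W p - T Y X Z W p + T Z X Y W p - T W X Y Z p"
    if X: "vf X" and Y: "vf Y" and Z: "vf Z" and W: "vf W" for X Y Z W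
    using ricci[OF X Y Z W, of p] ricci[OF Z W X Y, of p]
      Rm_pair[OF vf_F[OF X] Y Z W, of p] Rm_pair[OF X vf_F[OF Y] Z W, of p]
      T_swap12[OF Z X W Y, of p] T_swap23[OF Z X W Y, of p]
      T_swap12[OF W X Z Y, of p] T_swap23[OF W X Z Y, of p]
    unfolding E_def by linarith
  have cyc: "E Y Z X W = E X Y Z W"
    if X: "vf X" and Y: "vf Y" and Z: "vf Z" and W: "vf W" for X Y Z W
    using T_swap12[OF Y X Z W, of p] T_swap12[OF Z X Y W, of p] T_swap12[OF W X Y Z, of p]
      T_swap23[OF W Y X Z, of p]
    unfolding E_eq[OF X Y Z W] E_eq[OF Y Z X W] by linarith
  \<comment> \<open>Grouped by the argument on which \<open>F\<close> acts, the cyclic sum consists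
    of four Bianchi sums. By \<open>cyc\<close> its three terms agree.\<close>
  have "E X Y Z W + E Y Z X W + E Z X Y W = 0"
    using Rm_bianchi[OF vf_F[OF X] Y Z W, of p] Rm_bianchi[OF X vf_F[OF Y] Z W, of p]
      Rm_bianchi[OF X Y vf_F[OF Z] W, of p] Rm_bianchi[OF X Y Z vf_F[OF W], of p]
    unfolding E_def by linarith
  with cyc[OF X Y Z W] cyc[OF Y Z X W] show ?thesis
    unfolding E_def by linarith
qed

section \<open>Curvature along one characteristic field\<close>

context
  fixes i assumes i: "i \<in> {1..s}"
begin

abbreviation x :: "'m field"
  where "x \<equiv> \<xi> i"

lemma vf_x: "vf x"
  using i by simp

text \<open>Differentiating f \<xi> = 0 gives (nabla_X f)\<xi> = -f(nabla_X \<xi>); then swap the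
  arguments. In particular nabla_\<xi> f has horizontal values.\<close>

lemma dF_x_eq:
  assumes "vf X"
  shows "dF x X = F (nabla X x)"
proof -
  have "nabla X (F x) = 0"
    using nabla_diff(2)[OF assms vf_x vf_x] by (simp add: F_xi[OF i])
  then show ?thesis
    unfolding dF_swap[OF vf_x assms] by (simp add: cov_deriv11_def)
qed

lemma hor_dF_x: "vf X \<Longrightarrow> hor (dF x X)"
  by (simp add: dF_x_eq vf_x)

text \<open>The anticommutator \<open>?V\<close> has horizontal values, so
  \<open>dF_anticommute\<close> kills it on horizontal fields. Its symmetry extends this to all
  fields.\<close>

lemma dF_x_anticommute:
  assumes "vf X"
  shows "dF x (F X) = - F (dF x X)"
proof -
  let ?V = "\<lambda>X. dF x (F X) + F (dF x X)"
  have hor_V: "hor (?V X)" if "vf X" for X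
    using that by (simp add: hor_dF_x vf_x)
  have V_hor: "?V X = 0" if "hor X" for X
  proof (rule ip_self_eq_zero)
    have "ip (?V X) W p = 0" if "hor W" for W p
      using dF_anticommute[OF vf_x \<open>hor X\<close> that, of p] \<open>hor X\<close> that
      by (simp add: ip_add vf_x)
    then show "ip (?V X) (?V X) p = 0" for p
      using hor_V[OF hor_vf[OF \<open>hor X\<close>]] by blast
  qed (use that in \<open>simp add: vf_x\<close>)
  have "?V X = 0"
  proof (rule ip_self_eq_zero)
    fix p
    let ?W = "?V X"
    have W: "hor ?W" "vf ?W"
      using hor_V[OF assms] by simp_all
    \<comment> \<open>The anticommutator of two skew maps is symmetric; choosing \<open>W\<close> as
      the horizontal field \<open>?V X\<close> makes \<open>?V W\<close> vanish.\<close>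
    have "ip ?W W p = ip X (?V W) p" if "vf W" for W
      using assms that by (simp add: ip_linear dF_skew F_skew vf_x)
    from this[OF W(2)] V_hor[OF W(1)] show "ip ?W ?W p = 0"
      using assms by (simp only: ip_zero)
  qed (use assms in \<open>simp add: vf_x\<close>)
  then show ?thesis
    by (simp add: eq_neg_iff_add_eq_0)
qed

text \<open>This is the derivative along \<open>X\<close> of the relation in
  \<open>dF_x_anticommute\<close>, paired with \<open>W\<close>.\<close>

lemma T_x_F:
  assumes "vf X" "hor Z" "hor W"
  shows "T X x (F Z) W p - T X x Z (F W) p
    = ip (dF X Z) (dF x W) p + ip (dF x Z) (dF X W) p"
proof -
  let ?U = "nabla X x"
  have "d2F X x (F Z) + F (d2F X x Z)
      = - dF X (dF x Z) - dF x (dF X Z) - (dF ?U (F Z) + F (dF ?U Z))"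
  proof -
    have "nabla X (dF x (F Z)) = - (dF X (dF x Z) + F (nabla X (dF x Z)))"
      using assms by (simp add: dF_x_anticommute nabla_linear vf_x cov_deriv11_def[of _ _ X])
    moreover have "nabla X (F Z) = dF X Z + F (nabla X Z)"
      by (simp add: cov_deriv11_def)
    then have "dF x (nabla X (F Z)) = dF x (dF X Z) - F (dF x (nabla X Z))"
      using assms by (simp add: dF_add dF_x_anticommute vf_x)
    ultimately show ?thesis
      using assms by (simp add: d2F_def F_linear vf_x)
  qed
  then have "ip (d2F X x (F Z) + F (d2F X x Z)) W p
      = ip (- dF X (dF x Z) - dF x (dF X Z) - (dF ?U (F Z) + F (dF ?U Z))) W p"
    by simp
  \<comment> \<open>The direction \<open>?U\<close> may have a vertical part, but
    \<open>dF_anticommute\<close> admits any direction.\<close>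
  moreover have "ip (dF ?U (F Z) + F (dF ?U Z)) W p = 0"
    using assms dF_anticommute[of ?U Z W p] by (simp add: ip_linear vf_x)
  ultimately show ?thesis
    using assms by (simp add: ip_linear F_skew dF_skew vf_x)
qed

lemma curvature_F_x:
  assumes "vf X" "vf Y"
  shows "curvature nabla X Y (F x) = 0"
proof -
  have "nabla V 0 = 0" if "vf V" for V
    using nabla_diff(2)[OF that vf_x vf_x] by simp
  then show ?thesis
    using assms F_xi[OF i] by (simp add: curvature_def)
qed

text \<open>With \<xi> in the third slot of the Ricci identity, f \<xi> = 0 leaves a single
  curvature term.\<close>

lemma ricci_x:
  assumes "vf X" "vf Y" "vf W"
  shows "Rm X Y x (F W) p = T Y x X W p - T X x Y W p"
  using curvature_F_x[OF assms(1,2)] ricci[OF assms(1,2) vf_x assms(3), of p] T_swap12[OF assms(1) vf_x assms(2,3), of p]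
    T_swap12[OF assms(2) vf_x assms(1,3), of p] ip_zero(1)[OF assms(3), of p]
  by simp

lemma ricci_x_F:
  assumes "vf X" "vf Y" "hor W"
  shows "Rm X Y x W p = T X x Y (F W) p - T Y x X (F W) p"
  using ricci_x[OF assms(1,2) vf_F[OF hor_vf[OF assms(3)]], of p] assms
  by (simp add: ip_linear vf_x)

lemma Rm_x_bianchi:
  assumes X: "vf X" and Y: "vf Y" and Z: "vf Z"
  shows "Rm X Y x Z p + Rm Y Z x X p + Rm Z X x Y p = 0"
  using Rm_bianchi[OF X Y Z vf_x, of p] Rm_skew34[OF X Y Z vf_x, of p]
    Rm_skew34[OF Y Z X vf_x, of p] Rm_skew34[OF Z X Y vf_x, of p]
  by linarith

text \<open>The diagonal case whose polarization relates the outer arguments of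
  \<open>Rm (F X) Y x Z\<close>. Everything is reduced to values of \<open>?t\<close> and one
  quadratic quantity \<open>\<pi>\<close>, which cancels at the end.\<close>

lemma Rm_x_F_diagonal:
  assumes "hor Y" "hor W"
  shows "Rm (F Y) W x Y p = 0"
proof -
  have Y: "vf Y" and W: "vf W" and FY: "vf (F Y)" and FW: "vf (F W)"
    using assms by simp_all
  have hFW: "hor (F W)"
    using W by simp
  let ?t = "\<lambda>X Y Z. T X x Y Z p"
  define \<pi> where "\<pi> = ip (dF x Y) (dF Y (F W)) p"
  have skew: "?t X V U = - ?t X U V" if "vf X" "vf U" "vf V" for X U V
    using T_swap23[OF that(1) vf_x that(2,3)] .
  have diag: "?t X V V = 0" if "vf X" "vf V" for X V
    using skew[OF that that(2)] by simp
  \<comment> \<open>Swapping arguments and anticommuting twice moves \<open>F\<close> from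
    \<open>Y\<close> to \<open>W\<close>; the test field \<open>dF x Y\<close> is horizontal, as
    anticommutation requires.\<close>
  have "ip (dF x Y) (dF (F Y) W) p = \<pi>"
  proof -
    have "ip (dF W (F Y)) (dF x Y) p = - ip (F (dF W Y)) (dF x Y) p"
      by (rule dF_anticommute[OF W assms(1) hor_dF_x[OF Y]])
    also have "\<dots> = ip (F (dF Y W)) (dF x Y) p"
      using Y W by (simp add: dF_swap[of W Y] F_linear ip_linear vf_x)
    also have "\<dots> = - ip (dF Y (F W)) (dF x Y) p"
      using dF_anticommute[OF Y assms(2) hor_dF_x[OF Y], of p] by simp
    finally show ?thesis
      using Y W FY FW by (simp add: \<pi>_def dF_swap[of "F Y" W] ip_linear ip_commute vf_x)
  qed
  moreover have "ip (dF (F Y) Y) (dF x W) p = 0"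
    using dF_anticommute[OF Y assms(1) hor_dF_x[OF W], of p] F_diff[OF Y Y] Y W FY
    by (simp add: dF_swap[of "F Y" Y] dF_self ip_linear F_skew vf_x)
  ultimately have C1: "?t (F Y) (F Y) W - ?t (F Y) Y (F W) = \<pi>"
    using T_x_F[OF FY assms, of p] by simp
  have C2: "?t Y (F Y) (F W) + ?t Y Y W = \<pi>"
    using T_x_F[OF Y assms(1) hFW, of p] assms Y W
    by (simp add: \<pi>_def dF_self ip_linear vf_x)
  have "ip (dF x Y) (dF (F W) Y) p = - \<pi>"
    using Y W by (simp add: \<pi>_def dF_swap[of "F W" Y] ip_linear vf_x)
  \<comment> \<open>With \<open>Y\<close> in both last slots of \<open>T_x_F\<close> the quadratic
    terms coincide and skewness doubles the left side, so a factor 2 cancels.\<close>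
  then have C3: "?t (F W) Y (F Y) = \<pi>"
    using T_x_F[OF FW assms(1,1), of p] skew[OF FW FY Y] ip_commute[of "dF x Y" "dF (F W) Y" p]
      Y FW by (simp add: vf_x)
  have v: "Rm (F Y) W x Y p = - ?t (F Y) (F Y) W"
    using ricci_x_F[OF FY W assms(1), of p] diag[OF W FY] skew[OF FY FY W] by simp
  have "Rm (F Y) W x Y p + ?t Y W Y + (?t Y (F Y) (F W) - ?t (F Y) Y (F W)) = 0"
    using Rm_x_bianchi[OF FY W Y, of p] ricci_x[OF W Y Y, of p] diag[OF W Y]
      ricci_x_F[OF Y FY assms(2), of p]
    by linarith
  \<comment> \<open>Pair symmetry moves \<open>x\<close> to the first slot; in the Ricci identity
    there \<open>T x Y Y W\<close> vanishes by skewness.\<close>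
  moreover have "Rm (F Y) W x Y p + (?t Y (F W) (F Y) - ?t (F W) Y (F Y)) = - ?t Y Y W"
    using Rm_pair[OF FY W vf_x Y, of p] ricci[OF vf_x Y Y W, of p]
      Rm_pair[OF vf_x Y Y FW, of p] ricci_x_F[OF Y FW assms(1), of p]
      T_swap12[OF vf_x Y Y W, of p]
    by linarith
  \<comment> \<open>Let R be the sought value and d = \<open>?t Y (F Y) (F W) - ?t Y Y W\<close>. By
    \<open>C1\<close>, \<open>v\<close> and \<open>C3\<close> the last two relations become 2R + d +
    \<pi> = 0 and R - d = \<pi>; their sum gives 3R = 0.\<close>
  ultimately show ?thesis
    using C1 C2 C3 v skew[OF Y Y W] skew[OF Y FY FW] by linarith
qed

lemma Rm_x_hor:
  assumes "hor X" "hor Y" "hor Z"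
  shows "Rm X Y x Z p = 0"
proof (rule skew_complex_form_zero[where H=hor and J=F and r="\<lambda>X Y Z. Rm X Y x Z p"])
  fix X Y Z assume h: "hor X" "hor Y" "hor Z"
  then have X: "vf X" and Y: "vf Y" and Z: "vf Z"
    by simp_all
  show "Rm Y X x Z p = - Rm X Y x Z p"
    by (rule Rm_skew12[OF X Y vf_x Z])
  show "Rm (F (F X)) Y x Z p = - Rm X Y x Z p" "Rm X Y x (F (F Z)) p = - Rm X Y x Z p"
    using h by (simp_all add: curvature_minus ip_linear vf_x)
  \<comment> \<open>Of the four terms of the derivation identity, the one containing
    \<open>F x\<close> vanishes.\<close>
  show "Rm (F X) Y x Z p + Rm X (F Y) x Z p + Rm X Y x (F Z) p = 0"
    using curvature_f_derivation[OF X Y vf_x Z, of p] curvature_F_x[OF X Y]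
      ip_zero(1)[OF Z, of p] by simp
  \<comment> \<open>Polarization of the diagonal identity at \<open>X + Z\<close>.\<close>
  show "Rm (F X) Y x Z p + Rm (F Z) Y x X p = 0"
    using Rm_x_F_diagonal[of "X + Z" Y p] Rm_x_F_diagonal[OF h(1,2), of p]
      Rm_x_F_diagonal[OF h(3,2), of p] h
    by (simp add: F_add curvature_add ip_linear vf_x)
qed (use assms in simp_all)

end

section \<open>Curvature invariance of the contact distribution\<close>

lemma curvature_section:
  assumes "section_of A (contact_distribution A s \<eta>) X"
    and "section_of A (contact_distribution A s \<eta>) Y"
    and "section_of A (contact_distribution A s \<eta>) Z"
  shows "section_of A (contact_distribution A s \<eta>) (curvature nabla X Y Z)"
proof -
  have h: "hor X" "hor Y" "hor Z"
    using assms by (simp_all add: hor_section)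
  then have vf: "vf X" "vf Y" "vf Z"
    by simp_all
  have "\<eta> i p (curvature nabla X Y Z p) = 0" if i: "i \<in> {1..s}" for i p
  proof -
    \<comment> \<open>Metric duality turns vertical components into curvature values with \<xi>
      last; skewness then moves \<xi> to the slot treated in \<open>Rm_x_hor\<close>.\<close>
    have "\<eta> i p (curvature nabla X Y Z p) = Rm X Y Z (\<xi> i) p"
      using i vf ip_commute[of "\<xi> i" "curvature nabla X Y Z" p]
      by (simp add: eta_eq vf_tangent inner_fields_def)
    also have "\<dots> = - Rm X Y (\<xi> i) Z p"
      by (rule Rm_skew34[OF vf(1,2) vf_xi[OF i] vf(3)])
    finally show ?thesis
      using Rm_x_hor[OF i h] by simp
  qed
  with vf show ?thesis
    by (simp add: section_of_def contact_distribution_def vf_tangent)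
qed

end

theorem corollary1:
  fixes A :: "('m::{t2_space,second_countable_topology}, 'e::euclidean_space) chart set"
    and n s :: nat
    and f :: "'m \<Rightarrow> 'm tangent \<Rightarrow> 'm tangent"
    and \<xi> :: "nat \<Rightarrow> 'm field"
    and \<eta> :: "nat \<Rightarrow> 'm \<Rightarrow> 'm tangent \<Rightarrow> real"
    and g :: "'m metric_tensor"
    and nabla :: "'m connection"
    and X Y Z :: "'m field"
  assumes "nearly_C_manifold A n s f \<xi> \<eta> g nabla"
    and "section_of A (contact_distribution A s \<eta>) X"
    and "section_of A (contact_distribution A s \<eta>) Y"
    and "section_of A (contact_distribution A s \<eta>) Z"
  shows "section_of A (contact_distribution A s \<eta>) (curvature nabla X Y Z)"
proof -
  interpret nearly_C A g nabla n s f \<xi> \<eta>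
    using assms(1)
    by unfold_locales (simp_all add: nearly_C_manifold_def metric_f_structure_def)
  show ?thesis
    by (rule curvature_section[OF assms(2-4)])
qed

end
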